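(* Let $G$ be a group such that $\mathrm{gen}(G)$ is finite, and let $N$ be the (normal) subgroup of $G$ generated by all squares of elements of $G$. Then $$\mathrm{gen}(\mathrm{Core}(G))\ \geq\ \max(\mathrm{gen}(G)+1,\ [G:N]).$$ If, moreover, $G$ is abelian, then equality holds: $$\mathrm{gen}(\mathrm{Core}(G))\ =\ \max(\mathrm{gen}(G)+1,\ [G:N]).$$
   Context: An involutory quandle is a set $Q$ with a binary operation $\lhd$ such that for all $x,y,z\in Q$: $x\lhd x=x$; $x\lhd(x\lhd y)=y$; and $x\lhd(y\lhd z)=(x\lhd y)\lhd(x\lhd z)$. For a group $G$, $\mathrm{Core}(G)$ is the involutory quandle with the same underlying set as $G$ and operation $x\lhd y=xy^{-1}x$. For a group $G$, $\mathrm{gen}(G)$ denotes the minimum number of elements needed to generate $G$ as a group; for an involutory quandle $Q$, $\mathrm{gen}(Q)$ denotes the minimum number of elements needed to generate $Q$ as a quandle (i.e., the least cardinality of a subset of $Q$ whose closure under $\lhd$ is all of $Q$). *)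

theory Defs
  imports "HOL-Algebra.Generated_Groups" "HOL-Library.Extended_Nat"
begin

(* The quandle operation is written with a triangle because HOL-Algebra already uses
   the symbol \<lhd> for "is a normal subgroup of". *)

record 'a quandle = "'a partial_object" +
  qop :: "'a \<Rightarrow> 'a \<Rightarrow> 'a" (infixl "\<triangleleft>\<index>" 70)

locale involutory_quandle =
  fixes Q (structure)
  assumes qop_closed: "\<lbrakk>x \<in> carrier Q; y \<in> carrier Q\<rbrakk> \<Longrightarrow> x \<triangleleft> y \<in> carrier Q"
    and qop_idem: "x \<in> carrier Q \<Longrightarrow> x \<triangleleft> x = x"
    and qop_invol: "\<lbrakk>x \<in> carrier Q; y \<in> carrier Q\<rbrakk> \<Longrightarrow> x \<triangleleft> (x \<triangleleft> y) = y"
    and qop_distrib: "\<lbrakk>x \<in> carrier Q; y \<in> carrier Q; z \<in> carrier Q\<rbrakk> \<Longrightarrow>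
      x \<triangleleft> (y \<triangleleft> z) = (x \<triangleleft> y) \<triangleleft> (x \<triangleleft> z)"

definition Core :: "('a, 'b) monoid_scheme \<Rightarrow> 'a quandle" where
  "Core G = \<lparr>carrier = carrier G, qop = (\<lambda>x y. x \<otimes>\<^bsub>G\<^esub> inv\<^bsub>G\<^esub> y \<otimes>\<^bsub>G\<^esub> x)\<rparr>"

lemma carrier_Core [simp]: "carrier (Core G) = carrier G"
  by (simp add: Core_def)

lemma qop_Core [simp]: "x \<triangleleft>\<^bsub>Core G\<^esub> y = x \<otimes>\<^bsub>G\<^esub> inv\<^bsub>G\<^esub> y \<otimes>\<^bsub>G\<^esub> x"
  by (simp add: Core_def)

lemma (in group) involutory_quandle_Core: "involutory_quandle (Core G)"
proof
  fix x y z
  assume "x \<in> carrier (Core G)" "y \<in> carrier (Core G)"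
  then have xy: "x \<in> carrier G" "y \<in> carrier G"
    by simp_all
  show "x \<triangleleft>\<^bsub>Core G\<^esub> y \<in> carrier (Core G)"
    using xy by simp
  show "x \<triangleleft>\<^bsub>Core G\<^esub> (x \<triangleleft>\<^bsub>Core G\<^esub> y) = y"
    using xy by (simp add: inv_mult_group m_assoc inv_solve_left flip: m_assoc)
       (simp add: m_assoc)
  assume "z \<in> carrier (Core G)"
  then have z: "z \<in> carrier G"
    by simp
  have c: "inv a \<otimes> (a \<otimes> b) = b" "a \<otimes> (inv a \<otimes> b) = b"
    if "a \<in> carrier G" "b \<in> carrier G" for a b
    using that by (simp_all flip: m_assoc)
  show "x \<triangleleft>\<^bsub>Core G\<^esub> (y \<triangleleft>\<^bsub>Core G\<^esub> z) =
      (x \<triangleleft>\<^bsub>Core G\<^esub> y) \<triangleleft>\<^bsub>Core G\<^esub> (x \<triangleleft>\<^bsub>Core G\<^esub> z)"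
    using xy z by (simp add: inv_mult_group m_assoc c)
qed (simp add: m_assoc)

(* In an involutory quandle the inverse of the left translation by x is that translation
   itself, so closing under the operation alone gives the subquandle generated by S. *)
inductive_set qgenerate :: "('a, 'b) quandle_scheme \<Rightarrow> 'a set \<Rightarrow> 'a set"
  for Q and S where
    incl: "x \<in> S \<Longrightarrow> x \<in> qgenerate Q S"
  | qop: "\<lbrakk>x \<in> qgenerate Q S; y \<in> qgenerate Q S\<rbrakk> \<Longrightarrow> x \<triangleleft>\<^bsub>Q\<^esub> y \<in> qgenerate Q S"

(* Cardinalities are taken in enat: card would give 0 for infinite sets, and Core G need not
   be finitely generated even if G is.  All infinite cardinals are identified with infinity. *)
definition ecard :: "'a set \<Rightarrow> enat" where
  "ecard A = (if finite A then enat (card A) else \<infinity>)"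

definition gen_group :: "('a, 'b) monoid_scheme \<Rightarrow> enat" where
  "gen_group G = (INF S \<in> {S. S \<subseteq> carrier G \<and> generate G S = carrier G}. ecard S)"

definition gen_quandle :: "('a, 'b) quandle_scheme \<Rightarrow> enat" where
  "gen_quandle Q = (INF S \<in> {S. S \<subseteq> carrier Q \<and> qgenerate Q S = carrier Q}. ecard S)"

definition squares_subgroup :: "('a, 'b) monoid_scheme \<Rightarrow> 'a set" where
  "squares_subgroup G = generate G {x \<otimes>\<^bsub>G\<^esub> x | x. x \<in> carrier G}"

lemma (in group) squares_subgroup_normal: "squares_subgroup G \<lhd> G"
  unfolding squares_subgroup_def
proof (rule normal_generateI)
  fix h g
  assume h: "h \<in> {x \<otimes> x | x. x \<in> carrier G}" and g: "g \<in> carrier G"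
  then obtain x where x: "x \<in> carrier G" "h = x \<otimes> x"
    by blast
  have "g \<otimes> h \<otimes> inv g = (g \<otimes> x \<otimes> inv g) \<otimes> (g \<otimes> x \<otimes> inv g)"
    using x g by (simp add: m_assoc) (simp add: inv_solve_left flip: m_assoc)
  then show "g \<otimes> h \<otimes> inv g \<in> {x \<otimes> x | x. x \<in> carrier G}"
    using x g by blast
qed auto

definition group_index :: "('a, 'b) monoid_scheme \<Rightarrow> 'a set \<Rightarrow> enat" where
  "group_index G H = ecard (rcosets\<^bsub>G\<^esub> H)"

end

theory Submission
  imports Defs
begin

(* Left translations are automorphisms of Core G, so a quandle generating set may be moved to
   contain the identity, which is useless as a group generator; this gives gen G + 1.  Since
   y^-1 (x y^-1 x) is the square of y^-1 x, quandle operations never leave the cosets of N already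
   met, which gives [G : N].

   In the abelian case, a set S containing the identity generates Core G as soon as it generates
   G and meets every coset of N, because the generated quandle is stable under multiplication by
   squares of elements of S.  Among the group generating sets S with at most gen G + 1 elements
   and containing 1, take one meeting the most cosets.  If two of its elements a, b (b not 1) lie
   in the same coset and some coset is missed, then S - {b} still generates G modulo N, so b can be
   multiplied by an element of the subgroup generated by S - {b} to land in the missed coset,
   contradicting maximality.  So S meets all cosets, or it is part of a transversal of N. *)

section \<open>Cardinalities, transversals and attained minima\<close>

lemma ecard_image_le: "ecard (f ` A) \<le> ecard A"
  by (simp add: ecard_def card_image_le)

lemma ecard_image_inj_on: "inj_on f A \<Longrightarrow> ecard (f ` A) = ecard A"
  by (simp add: ecard_def card_image finite_image_iff)

text \<open>One preimage in \<open>A\<close> is chosen for each value of \<open>f\<close> that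
  \<open>S\<close> misses. With \<open>f\<close> the coset map this completes a partial
  transversal.\<close>

lemma inj_on_extend_transversal:
  assumes "inj_on f S" "S \<subseteq> A"
  obtains T where "S \<subseteq> T" "T \<subseteq> A" "inj_on f T" "f ` T = f ` A"
proof
  let ?g = "inv_into A f"
  let ?T = "S \<union> ?g ` (f ` A - f ` S)"
  have g: "f (?g y) = y" "?g y \<in> A" if "y \<in> f ` A" for y
    using that by (auto intro: f_inv_into_f inv_into_into)
  show "S \<subseteq> ?T" by blast
  show "?T \<subseteq> A" using assms(2) g(2) by blast
  have "inj_on f (?g ` (f ` A - f ` S))"
    by (rule inj_onI) (auto simp: g)
  moreover have "f ` ?g ` (f ` A - f ` S) = f ` A - f ` S"
    using g(1) by (simp add: image_image)
  ultimately show "inj_on f ?T"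
    using assms(1) by (simp add: inj_on_Un) blast
  show "f ` ?T = f ` A"
    using assms(2) g by (auto simp: image_Un image_image)
qed

lemma gen_group_le: "\<lbrakk>S \<subseteq> carrier G; generate G S = carrier G\<rbrakk> \<Longrightarrow> gen_group G \<le> ecard S"
  unfolding gen_group_def by (rule INF_lower) simp

lemma gen_quandle_le: "\<lbrakk>S \<subseteq> carrier Q; qgenerate Q S = carrier Q\<rbrakk> \<Longrightarrow> gen_quandle Q \<le> ecard S"
  unfolding gen_quandle_def by (rule INF_lower) simp

text \<open>The infimum is over a nonempty set, since \<open>carrier G\<close> generates
  \<open>G\<close>, and \<open>enat\<close> is well-ordered.\<close>

lemma (in group) gen_group_attained:
  obtains S where "S \<subseteq> carrier G" "generate G S = carrier G" "ecard S = gen_group G"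
proof -
  let ?A = "ecard ` {S. S \<subseteq> carrier G \<and> generate G S = carrier G}"
  have "generate G (carrier G) = carrier G"
    using generate_incl[of "carrier G"] by (auto intro: generate.incl)
  then have "ecard (carrier G) \<in> ?A" by blast
  then have "Inf ?A \<in> ?A" by (rule wellorder_InfI)
  then show ?thesis using that unfolding gen_group_def by auto
qed

section \<open>Lower bounds for the core of an arbitrary group\<close>

context group
begin

lemma qgenerate_Core_closed: "x \<in> carrier G" if "S \<subseteq> carrier G" "x \<in> qgenerate (Core G) S"
  using that(2) by induction (use that(1) in auto)

lemma qgenerate_Core_subset_generate: "qgenerate (Core G) S \<subseteq> generate G S"
  if "S \<subseteq> carrier G"
proof
  fix x assume "x \<in> qgenerate (Core G) S"
  then show "x \<in> generate G S"
  proof induction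
    case (qop x y)
    then show ?case
      using generate_m_inv_closed[OF that] by (simp add: generate.eng)
  qed (rule generate.incl)
qed

text \<open>In \<open>(a \<otimes> x) \<otimes> inv (a \<otimes> y) \<otimes> (a \<otimes>
  x)\<close> the inner factors \<open>inv a\<close> and \<open>a\<close> cancel, so left translation
  respects the core operation.\<close>

lemma qgenerate_Core_translate:
  assumes S: "S \<subseteq> carrier G" and a: "a \<in> carrier G" and "x \<in> qgenerate (Core G) S"
  shows "a \<otimes> x \<in> qgenerate (Core G) ((\<lambda>s. a \<otimes> s) ` S)"
  using assms(3)
proof induction
  case (qop x y)
  then have xy: "x \<in> carrier G" "y \<in> carrier G"
    using qgenerate_Core_closed[OF S] by auto
  have "a \<otimes> (x \<otimes> inv y \<otimes> x) = (a \<otimes> x) \<otimes> inv (a \<otimes> y) \<otimes> (a \<otimes> x)"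
    using a xy by (simp add: inv_mult_group m_assoc) (simp flip: m_assoc)
  then show ?case
    using qgenerate.qop[OF qop.IH] by simp
qed (auto intro: qgenerate.incl)

lemma generate_insert_one:
  assumes "S \<subseteq> carrier G"
  shows "generate G (insert \<one> S) = generate G S"
proof
  have "insert \<one> S \<subseteq> generate G S"
    by (auto intro: generate.one generate.incl)
  then show "generate G (insert \<one> S) \<subseteq> generate G S"
    by (rule generate_subgroup_incl) (rule generate_is_subgroup[OF assms])
  show "generate G S \<subseteq> generate G (insert \<one> S)"
    by (rule mono_generate) blast
qed

lemma gen_group_plus_one_le_qgenerating:
  assumes S: "S \<subseteq> carrier G" and gen: "qgenerate (Core G) S = carrier G"
  shows "gen_group G + 1 \<le> ecard S"
proof (cases "finite S")
  case True
  have "S \<noteq> {}"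
  proof
    assume "S = {}"
    have False if "x \<in> qgenerate (Core G) S" for x
      using that by induction (simp_all add: \<open>S = {}\<close>)
    then show False using gen one_closed by blast
  qed
  \<comment> \<open>Translation by \<open>inv s\<close> moves this base point to \<one>.\<close>
  then obtain s where s: "s \<in> S" "s \<in> carrier G" using S by blast
  let ?T = "(\<lambda>x. inv s \<otimes> x) ` S"
  have T: "?T \<subseteq> carrier G" "\<one> \<in> ?T" "finite ?T"
    using S s True by (auto intro!: image_eqI[of _ _ s])
  have "carrier G \<subseteq> generate G ?T"
  proof
    fix x assume x: "x \<in> carrier G"
    then have "s \<otimes> x \<in> qgenerate (Core G) S" using gen s by simp
    then have "inv s \<otimes> (s \<otimes> x) \<in> qgenerate (Core G) ?T"
      using qgenerate_Core_translate[OF S] s by simp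
    moreover have "inv s \<otimes> (s \<otimes> x) = x" using s x by (simp flip: m_assoc)
    ultimately show "x \<in> generate G ?T"
      using qgenerate_Core_subset_generate[OF T(1)] by auto
  qed
  \<comment> \<open>Deleting \<one> keeps the generated group and saves one element, which is the
    summand 1 of the bound.\<close>
  also have "generate G ?T = generate G (?T - {\<one>})"
    using generate_insert_one[of "?T - {\<one>}"] T by (simp add: insert_absorb subset_iff)
  finally have "generate G (?T - {\<one>}) = carrier G"
    using generate_incl[of "?T - {\<one>}"] T(1) by blast
  then have "gen_group G \<le> ecard (?T - {\<one>})"
    using T(1) by (intro gen_group_le) auto
  then have "gen_group G + 1 \<le> ecard (?T - {\<one>}) + 1"
    by (rule add_right_mono)
  also have "\<dots> = ecard ?T"
    using T card_Suc_Diff1[of ?T \<one>] by (simp add: ecard_def one_enat_def)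
  also have "\<dots> \<le> ecard S" by (rule ecard_image_le)
  finally show ?thesis .
qed (simp add: ecard_def)

section \<open>Cosets of the subgroup of squares and the bound by its index\<close>

lemma subgroup_squares: "subgroup (squares_subgroup G) G"
  using squares_subgroup_normal by (rule normal_imp_subgroup)

lemma square_in_squares_subgroup: "x \<in> carrier G \<Longrightarrow> x \<otimes> x \<in> squares_subgroup G"
  unfolding squares_subgroup_def by (rule generate.incl) blast

lemma r_coset_eq_iff:
  assumes "subgroup H G" "x \<in> carrier G" "y \<in> carrier G"
  shows "H #> x = H #> y \<longleftrightarrow> x \<otimes> inv y \<in> H"
proof
  assume "H #> x = H #> y"
  then have "x \<in> H #> y" using rcos_self[OF assms(2,1)] by simp
  then show "x \<otimes> inv y \<in> H"
    using assms by (auto simp: r_coset_def m_assoc subgroup.mem_carrier)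
next
  assume h: "x \<otimes> inv y \<in> H"
  have "x = (x \<otimes> inv y) \<otimes> y" using assms by (simp add: m_assoc)
  then have "x \<in> H #> y" using h by (auto simp: r_coset_def)
  then show "H #> x = H #> y" using repr_independence assms by auto
qed

lemma qgenerate_Core_coset:
  assumes S: "S \<subseteq> carrier G" and "x \<in> qgenerate (Core G) S"
  shows "squares_subgroup G #> x \<in> (\<lambda>s. squares_subgroup G #> s) ` S"
  using assms(2)
proof induction
  case (qop x y)
  then have xy: "x \<in> carrier G" "y \<in> carrier G"
    using qgenerate_Core_closed[OF S] by auto
  \<comment> \<open>For right cosets the relevant quotient is
    \<open>(x \<otimes> inv y \<otimes> x) \<otimes> inv y\<close>, the square of
    \<open>x \<otimes> inv y\<close>.\<close>
  have "(x \<otimes> inv y) \<otimes> (x \<otimes> inv y) \<in> squares_subgroup G"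
    using xy by (simp add: square_in_squares_subgroup)
  then have "squares_subgroup G #> (x \<triangleleft>\<^bsub>Core G\<^esub> y) = squares_subgroup G #> y"
    using xy by (simp add: r_coset_eq_iff[OF subgroup_squares] m_assoc)
  then show ?case using qop.IH by simp
qed blast

lemma rcosets_eq_image: "rcosets H = (\<lambda>x. H #> x) ` carrier G"
  by (auto simp: RCOSETS_def)

lemma group_index_le_qgenerating:
  assumes S: "S \<subseteq> carrier G" and gen: "qgenerate (Core G) S = carrier G"
  shows "group_index G (squares_subgroup G) \<le> ecard S"
proof -
  have "rcosets (squares_subgroup G) = (\<lambda>s. squares_subgroup G #> s) ` S"
    using qgenerate_Core_coset[OF S] S by (auto simp: rcosets_eq_image gen)
  then show ?thesis by (simp add: group_index_def ecard_image_le)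
qed

lemma gen_quandle_Core_ge:
  "max (gen_group G + 1) (group_index G (squares_subgroup G)) \<le> gen_quandle (Core G)"
  unfolding gen_quandle_def
  by (rule INF_greatest) (simp add: gen_group_plus_one_le_qgenerating group_index_le_qgenerating)

end

section \<open>Abelian groups: when a set generates the core\<close>

context comm_group
begin

text \<open>Squaring is an endomorphism of an abelian group, so the squares of generators generate
  all squares.\<close>

lemma squares_subgroup_subset_generate_squares:
  assumes S: "S \<subseteq> carrier G" and gen: "generate G S = carrier G"
  shows "squares_subgroup G \<subseteq> generate G ((\<lambda>s. s \<otimes> s) ` S)"
proof -
  let ?H = "generate G ((\<lambda>s. s \<otimes> s) ` S)"
  have H: "subgroup ?H G" using S by (intro generate_is_subgroup) auto
  have "x \<otimes> x \<in> ?H" if "x \<in> generate G S" for x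
    using that
  proof induction
    case one
    then show ?case by (simp add: generate.one)
  next
    case (incl h)
    then show ?case by (auto intro: generate.incl)
  next
    case (inv h)
    then have "inv (h \<otimes> h) \<in> ?H" by (auto intro: generate.inv)
    then show ?case using inv S by (simp add: inv_mult_group subset_iff)
  next
    case (eng h k)
    then have "h \<in> carrier G" "k \<in> carrier G" using gen by auto
    then have "(h \<otimes> k) \<otimes> (h \<otimes> k) = (h \<otimes> h) \<otimes> (k \<otimes> k)" by (simp add: m_ac)
    then show ?case using eng by (simp add: generate.eng)
  qed
  then show ?thesis
    unfolding squares_subgroup_def using gen
    by (intro generate_subgroup_incl[OF _ H]) auto
qed

lemma qgenerate_Core_eq_carrier:
  assumes S: "S \<subseteq> carrier G" and one: "\<one> \<in> S" and gen: "generate G S = carrier G"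
    and cosets: "(\<lambda>s. squares_subgroup G #> s) ` S = rcosets (squares_subgroup G)"
  shows "qgenerate (Core G) S = carrier G"
proof
  let ?C = "qgenerate (Core G) S"
  show "?C \<subseteq> carrier G" using qgenerate_Core_closed[OF S] by blast
  \<comment> \<open>The inverse is \<open>\<one> \<triangleleft> x\<close>.\<close>
  have neg: "inv x \<in> ?C" if "x \<in> ?C" for x
    using qgenerate.qop[OF qgenerate.incl[OF one] that] qgenerate_Core_closed[OF S that] by simp
  \<comment> \<open>By commutativity this element is \<open>s \<triangleleft> inv x\<close>.\<close>
  have sq: "s \<otimes> s \<otimes> x \<in> ?C" if "s \<in> S" "x \<in> ?C" for s x
  proof -
    have c: "s \<in> carrier G" "x \<in> carrier G" using that S qgenerate_Core_closed[OF S] by auto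
    have "s \<otimes> inv (inv x) \<otimes> s \<in> ?C"
      using qgenerate.qop[OF qgenerate.incl[OF that(1)] neg[OF that(2)]] by simp
    then show ?thesis using c by (simp add: m_ac)
  qed
  have transl: "h \<otimes> x \<in> ?C" if "h \<in> generate G ((\<lambda>s. s \<otimes> s) ` S)" "x \<in> ?C" for h x
    using that
  proof (induction arbitrary: x)
    case one
    then show ?case using qgenerate_Core_closed[OF S] by simp
  next
    case (incl h)
    then show ?case using sq by auto
  next
    case (inv h)
    then obtain s where s: "s \<in> S" "h = s \<otimes> s" by auto
    have c: "s \<in> carrier G" "x \<in> carrier G"
      using s S inv qgenerate_Core_closed[OF S] by auto
    \<comment> \<open>Inverting before and after turns multiplication by
      \<open>s \<otimes> s\<close> into multiplication by its inverse.\<close>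
    have "inv (s \<otimes> s \<otimes> inv x) \<in> ?C" using inv s by (intro neg sq) auto
    then show ?case using c s by (simp add: inv_mult m_ac)
  next
    case (eng h k)
    have "(\<lambda>s. s \<otimes> s) ` S \<subseteq> carrier G" using S by auto
    then have "h \<in> carrier G" "k \<in> carrier G" "x \<in> carrier G"
      using eng generate_in_carrier qgenerate_Core_closed[OF S] by blast+
    then show ?case using eng by (simp add: m_assoc)
  qed
  show "carrier G \<subseteq> ?C"
  proof
    fix g assume g: "g \<in> carrier G"
    then obtain s where s: "s \<in> S" "squares_subgroup G #> g = squares_subgroup G #> s"
      using cosets unfolding rcosets_eq_image by (metis imageE imageI)
    have sc: "s \<in> carrier G" using s S by auto
    \<comment> \<open>This quotient is a product of squares of elements of \<open>S\<close> and
      their inverses, so \<open>transl\<close> carries \<open>s\<close> to \<open>g\<close>.\<close>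
    have "g \<otimes> inv s \<in> squares_subgroup G"
      using s(2) r_coset_eq_iff[OF subgroup_squares g sc] by simp
    then have "g \<otimes> inv s \<otimes> s \<in> ?C"
      using squares_subgroup_subset_generate_squares[OF S gen] s
      by (auto intro: transl qgenerate.incl)
    then show "g \<in> ?C" using g sc by (simp add: m_assoc)
  qed
qed

section \<open>Exchanging a generator to meet a further coset\<close>

lemma generate_replace:
  assumes R: "R \<subseteq> carrier G" and b: "b \<in> carrier G" and w: "w \<in> generate G R"
  shows "generate G (insert b R) \<subseteq> generate G (insert (w \<otimes> b) R)"
proof -
  let ?H = "generate G (insert (w \<otimes> b) R)"
  have wc: "w \<in> carrier G" using w R generate_in_carrier by blast
  have H: "subgroup ?H G" using R b wc by (intro generate_is_subgroup) auto
  have "w \<in> ?H" using w mono_generate[of R "insert (w \<otimes> b) R"] by blast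
  moreover have "w \<otimes> b \<in> ?H" by (rule generate.incl) simp
  ultimately have "inv w \<otimes> (w \<otimes> b) \<in> ?H"
    using H by (simp add: subgroup.m_closed subgroup.m_inv_closed)
  moreover have "inv w \<otimes> (w \<otimes> b) = b" using wc b by (simp flip: m_assoc)
  ultimately show ?thesis
    by (intro generate_subgroup_incl[OF _ H]) (auto intro: generate.incl)
qed

text \<open>In an abelian group \<open>N <#> generate G R\<close> is a subgroup. It contains
  \<open>R\<close>, and also \<open>b\<close>, which differs from \<open>a \<in> R\<close> by an
  element of \<open>N\<close>.\<close>

lemma generate_modulo:
  assumes R: "R \<subseteq> carrier G" and b: "b \<in> carrier G" and a: "a \<in> R"
    and N: "subgroup N G" and ab: "N #> a = N #> b"
    and g: "g \<in> generate G (insert b R)"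
  shows "\<exists>w \<in> generate G R. N #> g = N #> w"
proof -
  have a': "a \<in> carrier G" using R a by auto
  have sub: "subgroup (N <#> generate G R) G"
    using mult_subgroups[OF N generate_is_subgroup[OF R]] .
  have "b \<otimes> inv a \<in> N" using ab r_coset_eq_iff[OF N b a'] by simp
  then have "(b \<otimes> inv a) \<otimes> a \<in> N <#> generate G R"
    using a by (auto simp: set_mult_def intro: generate.incl)
  then have "b \<in> N <#> generate G R" using a' b by (simp add: m_assoc)
  moreover have "x \<in> N <#> generate G R" if "x \<in> R" for x
  proof -
    have "\<one> \<otimes> x \<in> N <#> generate G R"
      using that subgroup.one_closed[OF N] by (auto simp: set_mult_def intro!: generate.incl)
    then show ?thesis using that R by (simp add: subset_iff)
  qed
  ultimately have "generate G (insert b R) \<subseteq> N <#> generate G R"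
    by (intro generate_subgroup_incl[OF _ sub]) auto
  then obtain n w where nw: "n \<in> N" "w \<in> generate G R" "g = n \<otimes> w"
    using g by (auto simp: set_mult_def)
  have "n \<in> carrier G" "w \<in> carrier G"
    using subgroup.mem_carrier[OF N nw(1)] generate_in_carrier[OF R nw(2)] .
  then have "N #> g = N #> w"
    using nw by (simp add: r_coset_eq_iff[OF N] m_assoc)
  then show ?thesis using nw by blast
qed

text \<open>Dropping \<open>b\<close> loses no coset, because \<open>a\<close> remains in the coset
  of \<open>b\<close>. The replacement is \<open>w \<otimes> b\<close>, where \<open>w\<close> is
  generated by the remaining elements and congruent to \<open>c \<otimes> inv b\<close> modulo
  \<open>N\<close>, so it lies in the coset of \<open>c\<close>.\<close>

lemma generate_meet_more_cosets:
  assumes S: "S \<subseteq> carrier G" "finite S" and gen: "generate G S = carrier G"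
    and N: "subgroup N G" and a: "a \<in> S" and b: "b \<in> S" "a \<noteq> b"
    and ab: "N #> a = N #> b" and c: "c \<in> carrier G" "N #> c \<notin> (\<lambda>s. N #> s) ` S"
  obtains b' where "b' \<in> carrier G" "generate G (insert b' (S - {b})) = carrier G"
    "card ((\<lambda>s. N #> s) ` S) < card ((\<lambda>s. N #> s) ` insert b' (S - {b}))"
proof -
  let ?R = "S - {b}" and ?f = "\<lambda>s. N #> s"
  have R: "?R \<subseteq> carrier G" and bc: "b \<in> carrier G" using S b by auto
  have Sb: "insert b ?R = S" using b by auto
  have cb: "c \<otimes> inv b \<in> generate G (insert b ?R)" unfolding Sb gen using c bc by simp
  obtain w where w: "w \<in> generate G ?R" "?f (c \<otimes> inv b) = ?f w"
    using generate_modulo[OF R bc _ N ab cb] a b by auto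
  have wc: "w \<in> carrier G" using w R generate_in_carrier by blast
  have "c \<otimes> inv (w \<otimes> b) = c \<otimes> inv b \<otimes> inv w"
    using c bc wc by (simp add: inv_mult_group m_assoc)
  moreover have "c \<otimes> inv b \<otimes> inv w \<in> N"
    using w(2) r_coset_eq_iff[OF N] c bc wc by simp
  ultimately have fc: "?f (w \<otimes> b) = ?f c"
    using r_coset_eq_iff[OF N c(1), of "w \<otimes> b"] bc wc by simp
  have "?f ` ?R = ?f ` S" using a b ab by auto
  then have "?f ` insert (w \<otimes> b) ?R = insert (?f c) (?f ` S)"
    using fc by simp
  then have "card (?f ` S) < card (?f ` insert (w \<otimes> b) ?R)"
    using c(2) S(2) by simp
  moreover have "generate G (insert (w \<otimes> b) ?R) = carrier G"
    using generate_replace[OF R bc w(1), unfolded Sb gen] generate_incl[of "insert (w \<otimes> b) ?R"]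
      R wc bc by (intro equalityI) simp_all
  ultimately show ?thesis using that[of "w \<otimes> b"] wc bc by blast
qed

lemma generating_set_inj_or_surj_on_cosets:
  assumes N: "subgroup N G" and fin: "gen_group G \<noteq> \<infinity>"
  obtains S where "S \<subseteq> carrier G" "\<one> \<in> S" "generate G S = carrier G" "ecard S \<le> gen_group G + 1"
    "inj_on (\<lambda>s. N #> s) S \<or> (\<lambda>s. N #> s) ` S = rcosets N"
proof -
  let ?f = "\<lambda>s. N #> s"
  obtain S0 where S0: "S0 \<subseteq> carrier G" "generate G S0 = carrier G" "ecard S0 = gen_group G"
    by (rule gen_group_attained)
  have finS0: "finite S0" using S0(3) fin by (auto simp: ecard_def split: if_splits)
  then have gen_card: "gen_group G = enat (card S0)" using S0(3) by (simp add: ecard_def)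
  \<comment> \<open>The successor leaves room for adding \<one> to a minimal generating set.\<close>
  define P where "P S \<longleftrightarrow> S \<subseteq> carrier G \<and> finite S \<and> \<one> \<in> S \<and> generate G S = carrier G \<and>
    card S \<le> Suc (card S0)" for S
  have "P (insert \<one> S0)"
    using S0 finS0 by (simp add: P_def generate_insert_one card_insert_if)
  \<comment> \<open>This uniform bound on the number of cosets met makes a maximal choice of
    \<open>S\<close> possible.\<close>
  moreover have "\<forall>S. P S \<longrightarrow> card (?f ` S) < Suc (Suc (card S0))"
    using card_image_le le_trans unfolding P_def by (metis le_imp_less_Suc)
  ultimately obtain S where S: "P S" and max: "\<And>T. P T \<Longrightarrow> card (?f ` T) \<le> card (?f ` S)"
    using ex_has_greatest_nat[of P _ "\<lambda>S. card (?f ` S)"] by blast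
  have "?f ` S = rcosets N" if not_inj: "\<not> inj_on ?f S"
  proof (rule ccontr)
    assume "?f ` S \<noteq> rcosets N"
    then obtain c where c: "c \<in> carrier G" "?f c \<notin> ?f ` S"
      using S by (auto simp: rcosets_eq_image P_def)
    obtain x y where xy: "x \<in> S" "y \<in> S" "x \<noteq> y" "?f x = ?f y"
      using not_inj unfolding inj_on_def by blast
    \<comment> \<open>At most one of the two colliding elements is \<one>; the other is taken as
      \<open>b\<close>, so that \<one> survives the exchange.\<close>
    then obtain a b where ab: "a \<in> S" "b \<in> S" "a \<noteq> b" "?f a = ?f b" "b \<noteq> \<one>"
      by (cases "y = \<one>") (use xy in force)+
    obtain b' where b': "b' \<in> carrier G" "generate G (insert b' (S - {b})) = carrier G"
      "card (?f ` S) < card (?f ` insert b' (S - {b}))"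
      using generate_meet_more_cosets[OF _ _ _ N ab(1-4) c] S unfolding P_def by blast
    have "card (insert b' (S - {b})) \<le> card S"
      using S ab(2) card_Suc_Diff1[of S b] by (simp add: P_def card_insert_if)
    then have "P (insert b' (S - {b}))"
      using S b' ab(5) by (auto simp: P_def)
    then show False using max b'(3) by fastforce
  qed
  moreover have "ecard S \<le> gen_group G + 1"
    using S by (simp add: P_def ecard_def gen_card one_enat_def)
  ultimately show ?thesis using that S unfolding P_def by blast
qed

lemma gen_quandle_Core_le:
  assumes "gen_group G \<noteq> \<infinity>"
  shows "gen_quandle (Core G) \<le> max (gen_group G + 1) (group_index G (squares_subgroup G))"
proof -
  let ?N = "squares_subgroup G"
  let ?f = "\<lambda>s. ?N #> s"
  obtain S where S: "S \<subseteq> carrier G" "\<one> \<in> S" "generate G S = carrier G"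
    "ecard S \<le> gen_group G + 1" "inj_on ?f S \<or> ?f ` S = rcosets ?N"
    using generating_set_inj_or_surj_on_cosets[OF subgroup_squares assms] .
  from S(5) show ?thesis
  proof
    assume "?f ` S = rcosets ?N"
    then have "gen_quandle (Core G) \<le> ecard S"
      using S qgenerate_Core_eq_carrier by (intro gen_quandle_le) auto
    also note S(4)
    finally show ?thesis by (simp add: le_max_iff_disj)
  next
    \<comment> \<open>Here \<open>S\<close> is a partial transversal; a full transversal containing
      it still generates \<open>G\<close> and has exactly as many elements as there are
      cosets.\<close>
    assume "inj_on ?f S"
    then obtain T where T: "S \<subseteq> T" "T \<subseteq> carrier G" "inj_on ?f T" "?f ` T = ?f ` carrier G"
      using S(1) by (rule inj_on_extend_transversal)
    have "generate G T = carrier G"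
      using mono_generate[OF T(1)] generate_incl[OF T(2)] S(3) by blast
    then have "gen_quandle (Core G) \<le> ecard T"
      using S T qgenerate_Core_eq_carrier[of T]
      by (intro gen_quandle_le) (auto simp: rcosets_eq_image)
    also have "\<dots> = group_index G ?N"
      using T(3,4) ecard_image_inj_on[of ?f T] by (simp add: group_index_def rcosets_eq_image)
    finally show ?thesis by (simp add: le_max_iff_disj)
  qed
qed

end

theorem theorem8p1:
  fixes G :: "('a, 'b) monoid_scheme"
  assumes "group G"
    and "gen_group G \<noteq> \<infinity>"
  shows "gen_quandle (Core G) \<ge> max (gen_group G + 1) (group_index G (squares_subgroup G)) \<and>
    (comm_group G \<longrightarrow>
      gen_quandle (Core G) = max (gen_group G + 1) (group_index G (squares_subgroup G)))"
  using group.gen_quandle_Core_ge[OF assms(1)] comm_group.gen_quandle_Core_le[OF _ assms(2)]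
  by (auto intro: antisym)

end
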